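(* Let $\mathcal U\subseteq\mathcal H$ be an $L_\star$-invariant subspace and suppose $$\frac{\operatorname{dist}(z_k-z_\star,\mathcal U)}{\|z_k-z_\star\|}\to0,\qquad \|(I-L_\star)(z_k-z_\star)\|\ge c_z\|z_k-z_\star\|\ \text{ eventually}$$ for some $c_z>0$. Suppose also that $$\|a_{k-1}-p_{k-1}\|=o(\|\Delta z_k\|).$$ Define $\mathcal V:=G_\star^{-1}(I-L_\star)\mathcal U$. Then $$\frac{\operatorname{dist}(d_k,\mathcal V)}{\|d_k\|}\longrightarrow0 .$$ Consequently, if $B_k\to G_\star$ on $\mathcal V$ in the sense that $\|(B_k-G_\star)\Pi_{\mathcal V}\|\to0$, where $\Pi_{\mathcal V}$ is the orthogonal projector onto $\mathcal V$, then the transported Dennis–Moré condition $$\frac{\|(B_k-\overline G_k)d_k\|}{\|d_k\|}\to0$$ holds.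
   Context: $\mathcal H$ is a finite-dimensional real Hilbert space, $f:\mathcal H\to\mathbb R$ is convex and twice continuously differentiable, $\sigma$-strongly convex and $\beta$-smooth ($0<\sigma\le\beta$), and $g:\mathcal H\to\mathbb R\cup\{+\infty\}$ is proper, closed, convex. For proper closed convex $h$, $P_{\gamma h}u:=\arg\min_x\{\gamma h(x)+\frac12\|x-u\|^2\}$ and $R_{\gamma h}:=2P_{\gamma h}-I$, with $I$ the identity. The numbers $\gamma,\alpha>0$ satisfy $|1-\alpha|+\alpha\delta<1$, where $\delta:=\max\{\frac{\gamma\beta-1}{\gamma\beta+1},\frac{1-\gamma\sigma}{1+\gamma\sigma}\}$. The point $z_\star$ is the unique fixed point of the exact Douglas–Rachford splitting (DRS) map $T=(1-\alpha)I+\alpha R_{\gamma g}R_{\gamma f}$, and $p_\star:=P_{\gamma f}z_\star$, $w_\star:=2p_\star-z_\star$, $G_\star:=I+\gamma\nabla^2f(p_\star)$. It is assumed that $P_{\gamma g}$ is Fréchet differentiable at $w_\star$ with derivative $Q_\star$; then $T$ is Fréchet differentiable at $z_\star$ and $$L_\star:=DT(z_\star)=(1-\alpha)I+\alpha(2Q_\star-I)(2G_\star^{-1}-I).$$ The sequence $z_k$ comes from an inexact (curvature-recycling) DRS iteration $z_{k+1}=z_k+2\alpha\bigl(P_{\gamma g}(2x_k-z_k)-x_k\bigr)$, where $x_k$ is an approximation of $p_k:=P_{\gamma f}z_k$ and the exact-gradient anchor is $a_k:=x_k$. Put $\Delta z_k:=z_k-z_{k-1}$, $d_k:=a_{k-1}-p_k$,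 $\phi_k(x):=\gamma f(x)+\frac12\|x-z_k\|^2$, and $\overline G_k:=\int_0^1\nabla^2\phi_k(p_k+td_k)\,dt$. It is assumed that $z_k\to z_\star$, $z_k\ne z_\star$, $d_k\ne0$, $d_k\to0$, $a_{k-1}\to p_\star$, $p_k\to p_\star$. The $B_k$ are self-adjoint positive definite operators (direct quasi-Newton models of the Hessian of $\phi_k$). $\operatorname{dist}$ is the distance in $\mathcal H$.
   Formalization: The second conclusion (the transported Dennis–Moré condition) is proved under the added hypothesis that the operators B_k are uniformly bounded, sup_k ‖B_k‖ < ∞; without such a bound it fails, since B_k may blow up on the complement of V. *)

theory Defs
  imports "HOL-Analysis.Analysis"
begin

definition grad :: "('a::euclidean_space \<Rightarrow> real) \<Rightarrow> 'a \<Rightarrow> 'a" where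
  "grad f x = (THE D. GDERIV f x :> D)"

definition hess :: "('a::euclidean_space \<Rightarrow> real) \<Rightarrow> 'a \<Rightarrow> 'a \<Rightarrow>\<^sub>L 'a" where
  "hess f x = Blinfun (frechet_derivative (grad f) (at x))"

definition twice_continuously_differentiable :: "('a::euclidean_space \<Rightarrow> real) \<Rightarrow> bool" where
  "twice_continuously_differentiable f \<longleftrightarrow>
     (\<forall>x. f differentiable (at x)) \<and> (\<forall>x. grad f differentiable (at x)) \<and>
     continuous_on UNIV (hess f)"

definition strongly_convex :: "real \<Rightarrow> ('a::euclidean_space \<Rightarrow> real) \<Rightarrow> bool" where
  "strongly_convex \<sigma> f \<longleftrightarrow> convex_on UNIV (\<lambda>x. f x - \<sigma> / 2 * (norm x)\<^sup>2)"

definition smooth :: "real \<Rightarrow> ('a::euclidean_space \<Rightarrow> real) \<Rightarrow> bool" where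
  "smooth \<beta> f \<longleftrightarrow> (\<forall>x. f differentiable (at x)) \<and> \<beta>-lipschitz_on UNIV (grad f)"

text \<open>Convexity and closedness (lower semicontinuity) of a function with values in
  the reals extended by \<open>\<infinity>\<close> are those of its epigraph.\<close>

definition epi :: "('a \<Rightarrow> ereal) \<Rightarrow> ('a \<times> real) set" where
  "epi h = {(x, r). h x \<le> ereal r}"

definition proper_closed_convex :: "('a::euclidean_space \<Rightarrow> ereal) \<Rightarrow> bool" where
  "proper_closed_convex h \<longleftrightarrow>
     (\<forall>x. h x \<noteq> -\<infinity>) \<and> (\<exists>x. h x \<noteq> \<infinity>) \<and> closed (epi h) \<and> convex (epi h)"

text \<open>\<open>prox \<gamma> h\<close> is \<open>P\<^bsub>\<gamma>h\<^esub>\<close> and \<open>refl_prox \<gamma> h\<close> is \<open>R\<^bsub>\<gamma>h\<^esub>\<close>.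
  For \<open>\<gamma> > 0\<close> and \<open>h\<close> proper closed convex the minimizer exists and is unique.\<close>

definition prox :: "real \<Rightarrow> ('a::euclidean_space \<Rightarrow> ereal) \<Rightarrow> 'a \<Rightarrow> 'a" where
  "prox \<gamma> h u = (ARG_MIN (\<lambda>x. ereal \<gamma> * h x + ereal (1/2 * (norm (x - u))\<^sup>2)) x. True)"

definition refl_prox :: "real \<Rightarrow> ('a::euclidean_space \<Rightarrow> ereal) \<Rightarrow> 'a \<Rightarrow> 'a" where
  "refl_prox \<gamma> h u = 2 *\<^sub>R prox \<gamma> h u - u"

definition drs_map ::
  "real \<Rightarrow> real \<Rightarrow> ('a::euclidean_space \<Rightarrow> real) \<Rightarrow> ('a \<Rightarrow> ereal) \<Rightarrow> 'a \<Rightarrow> 'a" where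
  "drs_map \<gamma> \<alpha> f g u =
     (1 - \<alpha>) *\<^sub>R u + \<alpha> *\<^sub>R refl_prox \<gamma> g (refl_prox \<gamma> (\<lambda>x. ereal (f x)) u)"

definition orth_proj :: "'a::euclidean_space set \<Rightarrow> 'a \<Rightarrow>\<^sub>L 'a" where
  "orth_proj V = Blinfun (\<lambda>x. THE y. y \<in> V \<and> (\<forall>v\<in>V. inner (x - y) v = 0))"

definition self_adjoint :: "('a::euclidean_space \<Rightarrow>\<^sub>L 'a) \<Rightarrow> bool" where
  "self_adjoint A \<longleftrightarrow> adjoint (blinfun_apply A) = blinfun_apply A"

definition positive_definite :: "('a::euclidean_space \<Rightarrow>\<^sub>L 'a) \<Rightarrow> bool" where
  "positive_definite A \<longleftrightarrow> (\<forall>x. x \<noteq> 0 \<longrightarrow> 0 < inner (blinfun_apply A x) x)"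

text \<open>The derivative of the DRS map at \<open>u\<close>, where \<open>G\<close> is
  \<open>I + \<gamma>\<nabla>\<^sup>2f(P\<^bsub>\<gamma>f\<^esub>u)\<close> and \<open>Q\<close> is the derivative of \<open>P\<^bsub>\<gamma>g\<^esub>\<close> at
  \<open>2P\<^bsub>\<gamma>f\<^esub>u - u\<close>; see \<open>drs_map_has_derivative\<close> below.\<close>

definition drs_deriv ::
  "real \<Rightarrow> ('a::euclidean_space \<Rightarrow>\<^sub>L 'a) \<Rightarrow> ('a \<Rightarrow> 'a) \<Rightarrow> 'a \<Rightarrow> 'a" where
  "drs_deriv \<alpha> G Q h =
     (let y = 2 *\<^sub>R inv (blinfun_apply G) h - h
      in (1 - \<alpha>) *\<^sub>R h + \<alpha> *\<^sub>R (2 *\<^sub>R Q y - y))"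

lemma grad_GDERIV:
  assumes "f differentiable (at x)"
  shows "GDERIV f x :> grad f x"
proof -
  obtain f' where f': "(f has_derivative f') (at x)"
    using assms by (auto simp: differentiable_def)
  have lin: "linear f'" using f' has_derivative_linear by blast
  have "f' h = inner h (adjoint f' 1)" for h
    using adjoint_works[OF lin, of h 1] by simp
  then have "f' = (\<lambda>h. inner h (adjoint f' 1))" by auto
  then have ex: "GDERIV f x :> adjoint f' 1"
    using f' unfolding gderiv_def by metis
  have uni: "D = E" if "GDERIV f x :> D" "GDERIV f x :> E" for D E
  proof -
    have "(\<lambda>h. inner h D) = (\<lambda>h. inner h E)"
      using that unfolding gderiv_def by (rule has_derivative_unique)
    then have "inner h D = inner h E" for h by meson
    then have "inner (D - E) (D - E) = 0" by (simp add: inner_diff_right)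
    then show ?thesis by simp
  qed
  show ?thesis unfolding grad_def
    by (rule theI[where P = "\<lambda>D. GDERIV f x :> D", OF ex]) (rule uni[OF _ ex])
qed

lemma hess_has_derivative:
  assumes "grad f differentiable (at x)"
  shows "(grad f has_derivative blinfun_apply (hess f x)) (at x)"
proof -
  have "(grad f has_derivative frechet_derivative (grad f) (at x)) (at x)"
    using assms frechet_derivative_works by blast
  moreover from this have "bounded_linear (frechet_derivative (grad f) (at x))"
    by (rule has_derivative_bounded_linear)
  ultimately show ?thesis unfolding hess_def by (simp add: bounded_linear_Blinfun_apply)
qed

lemma convex_grad_le:
  fixes f :: "'a::euclidean_space \<Rightarrow> real"
  assumes "convex_on UNIV f" and "f differentiable (at u)"
  shows "f x \<ge> f u + inner (grad f u) (x - u)"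
proof -
  let ?h = "\<lambda>t::real. f (u + t *\<^sub>R (x - u))"
  have cv: "convex_on UNIV ?h"
  proof (rule convex_onI)
    fix t a b :: real
    assume "0 < t" "t < 1"
    have eq: "u + ((1 - t) *\<^sub>R a + t *\<^sub>R b) *\<^sub>R (x - u)
        = (1 - t) *\<^sub>R (u + a *\<^sub>R (x - u)) + t *\<^sub>R (u + b *\<^sub>R (x - u))"
      by (simp add: algebra_simps)
    show "?h ((1 - t) *\<^sub>R a + t *\<^sub>R b) \<le> (1 - t) * ?h a + t * ?h b"
      unfolding eq using assms(1) \<open>0 < t\<close> \<open>t < 1\<close> by (intro convex_onD) auto
  qed auto
  have "(f has_derivative (\<lambda>h. inner h (grad f u))) (at (u + 0 *\<^sub>R (x - u)))"
    using grad_GDERIV[OF assms(2)] by (simp add: gderiv_def)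
  then have "(?h has_derivative (\<lambda>t. inner (t *\<^sub>R (x - u)) (grad f u))) (at 0)"
    by (rule has_derivative_compose[rotated]) (auto intro!: derivative_eq_intros)
  then have "(?h has_field_derivative inner (grad f u) (x - u)) (at 0)"
    by (simp add: has_field_derivative_def inner_commute mult_commute_abs)
  from convex_on_imp_above_tangent[OF cv _ _ _ this, of 1] show ?thesis by simp
qed

lemma convex_grad_mono:
  fixes f :: "'a::euclidean_space \<Rightarrow> real"
  assumes "convex_on UNIV f" and "\<And>x. f differentiable (at x)"
  shows "inner (grad f x - grad f y) (x - y) \<ge> 0"
  using convex_grad_le[OF assms(1) assms(2)[of x], of y]
    convex_grad_le[OF assms(1) assms(2)[of y], of x]
  by (simp add: inner_diff_left inner_diff_right)

lemma prox_equation: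
  fixes f :: "'a::euclidean_space \<Rightarrow> real"
  assumes cv: "convex_on UNIV f" and df: "\<And>x. f differentiable (at x)" and g0: "\<gamma> > 0"
  defines "P \<equiv> prox \<gamma> (\<lambda>x. ereal (f x))"
  shows "P u + \<gamma> *\<^sub>R grad f (P u) = u"
proof -
  let ?\<phi> = "\<lambda>x. \<gamma> * f x + 1/2 * (norm (x - u))\<^sup>2"
  let ?v = "\<gamma> *\<^sub>R grad f u"
  let ?C = "cball u (2 * norm ?v)"
  have "continuous_on ?C f"
    using df differentiable_imp_continuous_within
    by (intro continuous_at_imp_continuous_on) auto
  then have "continuous_on ?C ?\<phi>" by (intro continuous_intros)
  moreover have "?C \<noteq> {}" by (simp add: not_less)
  ultimately have "\<exists>m\<in>?C. \<forall>x\<in>?C. ?\<phi> m \<le> ?\<phi> x"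
    by (intro continuous_attains_inf) simp_all
  then obtain m where m: "m \<in> ?C" "\<And>x. x \<in> ?C \<Longrightarrow> ?\<phi> m \<le> ?\<phi> x"
    by blast
  have "?\<phi> m \<le> ?\<phi> x" for x
  proof (cases "x \<in> ?C")
    case False
    then have far: "2 * norm ?v < norm (x - u)" by (simp add: dist_norm norm_minus_commute)
    have "\<gamma> * (f u + inner (grad f u) (x - u)) \<le> \<gamma> * f x"
      using convex_grad_le[OF cv df] g0 by (intro mult_left_mono) auto
    then have "\<gamma> * f u + inner ?v (x - u) \<le> \<gamma> * f x" by (simp add: algebra_simps)
    moreover have "- (norm ?v * norm (x - u)) \<le> inner ?v (x - u)"
      using Cauchy_Schwarz_ineq2[of ?v "x - u"] by linarith
    moreover have "2 * norm ?v * norm (x - u) \<le> norm (x - u) * norm (x - u)"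
      using far by (intro mult_right_mono) auto
    ultimately have "\<gamma> * f u \<le> ?\<phi> x" by (simp add: power2_eq_square)
    moreover have "?\<phi> m \<le> \<gamma> * f u" using m(2)[of u] by simp
    ultimately show ?thesis by simp
  qed (use m in auto)
  then have "is_arg_min (\<lambda>x. ereal \<gamma> * ereal (f x) + ereal (1/2 * (norm (x - u))\<^sup>2)) (\<lambda>_. True) m"
    by (auto simp: is_arg_min_def not_less)
  then have "is_arg_min (\<lambda>x. ereal \<gamma> * ereal (f x) + ereal (1/2 * (norm (x - u))\<^sup>2)) (\<lambda>_. True) (P u)"
    unfolding P_def prox_def arg_min_def by (rule someI)
  then have min: "?\<phi> (P u) \<le> ?\<phi> x" for x
    by (auto simp: is_arg_min_def not_less)
  have gd: "(f has_derivative (\<lambda>h. inner h (grad f (P u)))) (at (P u))"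
    using grad_GDERIV[OF df] by (simp add: gderiv_def)
  have "(?\<phi> has_derivative (\<lambda>h. inner h (\<gamma> *\<^sub>R grad f (P u) + (P u - u)))) (at (P u))"
    unfolding power2_norm_eq_inner
    by (rule derivative_eq_intros gd refl | simp add: fun_eq_iff algebra_simps inner_commute)+
  from differential_zero_maxmin[OF _ open_UNIV this] min
  have "(\<lambda>h. inner h (\<gamma> *\<^sub>R grad f (P u) + (P u - u))) = (\<lambda>h. 0)" by auto
  from fun_cong[OF this, of "\<gamma> *\<^sub>R grad f (P u) + (P u - u)"]
  have "\<gamma> *\<^sub>R grad f (P u) + (P u - u) = 0" by (simp only: inner_eq_zero_iff)
  then show ?thesis by (simp add: algebra_simps)
qed

lemma prox_has_derivative:
  fixes f :: "'a::euclidean_space \<Rightarrow> real" and u :: 'a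
  assumes cv: "convex_on UNIV f" and c2: "twice_continuously_differentiable f" and g0: "\<gamma> > 0"
  defines "P \<equiv> prox \<gamma> (\<lambda>x. ereal (f x))"
  defines "G \<equiv> id_blinfun + \<gamma> *\<^sub>R hess f (P u)"
  shows "bij (blinfun_apply G)" and "(P has_derivative inv (blinfun_apply G)) (at u)"
proof -
  let ?F = "\<lambda>x. x + \<gamma> *\<^sub>R grad f x"
  have df: "\<And>x. f differentiable (at x)" and dg: "\<And>x. grad f differentiable (at x)"
    using c2 by (auto simp: twice_continuously_differentiable_def)
  have PF: "?F (P v) = v" for v
    unfolding P_def using prox_equation[OF cv df g0] .
  have mono: "inner (?F x - ?F y) (x - y) \<ge> (norm (x - y))\<^sup>2" for x y
  proof -
    have "inner (?F x - ?F y) (x - y) = (norm (x - y))\<^sup>2 + \<gamma> * inner (grad f x - grad f y) (x - y)"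
      by (simp add: power2_norm_eq_inner algebra_simps)
    then show ?thesis using convex_grad_mono[OF cv df, of x y] g0 by simp
  qed
  have exp: "norm (x - y) \<le> norm (?F x - ?F y)" for x y
  proof (cases "x = y")
    case False
    have "norm (x - y) * norm (x - y) \<le> norm (?F x - ?F y) * norm (x - y)"
      using mono[of x y] norm_cauchy_schwarz[of "?F x - ?F y" "x - y"]
      by (simp add: power2_eq_square)
    then show ?thesis using False by simp
  qed simp
  have "norm (P v - P w) \<le> norm (v - w)" for v w
    using exp[of "P v" "P w"] by (simp add: PF)
  then have "1-lipschitz_on UNIV P"
    by (intro lipschitz_onI) (auto simp: dist_norm)
  then have "continuous_on UNIV P" by (rule lipschitz_on_continuous_on)
  then have cont: "continuous (at u) P"
    using continuous_on_eq_continuous_within by blast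
  have hd: "(grad f has_derivative blinfun_apply (hess f (P u))) (at (P u))"
    using hess_has_derivative[OF dg] .
  have FG: "(?F has_derivative blinfun_apply G) (at (P u))"
    unfolding G_def
    by (rule derivative_eq_intros hd refl
        | simp add: fun_eq_iff blinfun.add_left blinfun.scaleR_left)+
  have pos: "inner (blinfun_apply (hess f (P u)) h) h \<ge> 0" for h
  proof -
    let ?\<psi> = "\<lambda>t::real. inner (grad f (P u + t *\<^sub>R h)) h"
    have "mono_on UNIV ?\<psi>"
    proof (rule mono_onI)
      fix r s :: real assume "r \<le> s"
      show "?\<psi> r \<le> ?\<psi> s"
      proof (cases "r = s")
        case False
        have "0 \<le> (s - r) * (?\<psi> s - ?\<psi> r)"
          using convex_grad_mono[OF cv df, of "P u + s *\<^sub>R h" "P u + r *\<^sub>R h"]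
          by (simp add: inner_diff_left flip: scaleR_left_diff_distrib)
        then show ?thesis using False \<open>r \<le> s\<close> by (simp add: zero_le_mult_iff)
      qed simp
    qed
    moreover have "(?\<psi> has_real_derivative inner (blinfun_apply (hess f (P u)) h) h) (at 0)"
    proof -
      have "((\<lambda>t. grad f (P u + t *\<^sub>R h)) has_derivative
          (\<lambda>t. blinfun_apply (hess f (P u)) (t *\<^sub>R h))) (at (0::real))"
        by (rule has_derivative_compose[where g = "grad f"])
          (auto intro!: derivative_eq_intros simp: hd)
      then have "(?\<psi> has_derivative
          (\<lambda>t. inner (blinfun_apply (hess f (P u)) (t *\<^sub>R h)) h)) (at (0::real))"
        by (rule has_derivative_inner_left)
      then show ?thesis
        by (simp add: has_field_derivative_def blinfun.scaleR_right mult_commute_abs)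
    qed
    ultimately show ?thesis by (rule mono_on_imp_deriv_nonneg) simp
  qed
  have "h = 0" if "blinfun_apply G h = 0" for h
  proof -
    have "inner h h + \<gamma> * inner (blinfun_apply (hess f (P u)) h) h = inner (blinfun_apply G h) h"
      by (simp add: G_def blinfun.add_left blinfun.scaleR_left inner_add_left)
    then have "inner h h \<le> 0" using that pos[of h] g0
      by (smt (verit) inner_zero_left mult_nonneg_nonneg)
    then show ?thesis using inner_ge_zero[of h] inner_eq_zero_iff[of h] by linarith
  qed
  then have inj: "inj (blinfun_apply G)"
    using linear_injective_0[of "blinfun_apply G"]
    by (simp add: bounded_linear.linear blinfun.bounded_linear_right)
  have lin: "linear (blinfun_apply G)"
    by (simp add: bounded_linear.linear blinfun.bounded_linear_right)
  show bij: "bij (blinfun_apply G)"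
    using inj linear_injective_imp_surjective[OF lin] by (auto simp: bij_def)
  have "linear (inv (blinfun_apply G))"
    using lin inj linear_injective_isomorphism[OF lin inj] bij
    by (metis inj_linear_imp_inv_linear)
  then have bl: "bounded_linear (inv (blinfun_apply G))"
    by (simp add: linear_conv_bounded_linear)
  show "(P has_derivative inv (blinfun_apply G)) (at u)"
    by (rule has_derivative_inverse_basic[OF FG bl _ cont open_UNIV])
      (use PF inj in auto)
qed

lemma drs_map_has_derivative:
  fixes f :: "'a::euclidean_space \<Rightarrow> real"
  assumes "convex_on UNIV f" and "twice_continuously_differentiable f" and "\<gamma> > 0"
    and p: "p = prox \<gamma> (\<lambda>x. ereal (f x)) u"
    and Q: "(prox \<gamma> g has_derivative Q) (at (2 *\<^sub>R p - u))"
    and G: "G = id_blinfun + \<gamma> *\<^sub>R hess f p"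
  shows "(drs_map \<gamma> \<alpha> f g has_derivative drs_deriv \<alpha> G Q) (at u)"
proof -
  let ?P = "prox \<gamma> (\<lambda>x. ereal (f x))"
  have dP: "(?P has_derivative inv (blinfun_apply G)) (at u)"
    unfolding G p using assms(1-3) by (rule prox_has_derivative)
  have dR: "((\<lambda>v. 2 *\<^sub>R ?P v - v) has_derivative (\<lambda>h. 2 *\<^sub>R inv (blinfun_apply G) h - h)) (at u)"
    by (intro derivative_intros dP)
  have Q': "(prox \<gamma> g has_derivative Q) (at (2 *\<^sub>R ?P u - u))" using Q p by simp
  have dQ: "((\<lambda>v. prox \<gamma> g (2 *\<^sub>R ?P v - v)) has_derivative
      (\<lambda>h. Q (2 *\<^sub>R inv (blinfun_apply G) h - h))) (at u)"
    by (rule has_derivative_compose[OF dR Q'])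
  have "((\<lambda>v. (1 - \<alpha>) *\<^sub>R v + \<alpha> *\<^sub>R (2 *\<^sub>R prox \<gamma> g (2 *\<^sub>R ?P v - v) - (2 *\<^sub>R ?P v - v)))
      has_derivative (\<lambda>h. (1 - \<alpha>) *\<^sub>R h + \<alpha> *\<^sub>R (2 *\<^sub>R Q (2 *\<^sub>R inv (blinfun_apply G) h - h)
        - (2 *\<^sub>R inv (blinfun_apply G) h - h)))) (at u)"
    by (intro derivative_intros dQ dR)
  then show ?thesis
    by (simp add: drs_map_def[abs_def] refl_prox_def drs_deriv_def[abs_def] Let_def)
qed

end

theory Submission
  imports Defs "HOL-Library.Landau_Symbols"
begin

text \<open>
  Write \<open>e\<^sub>k = z\<^sub>k - z\<^sub>\<star>\<close>, \<open>S = G\<^sub>\<star>\<inverse>\<close> and \<open>\<xi>\<^sub>k = x\<^sub>k - p\<^sub>k\<close>. Expanding both proximal maps to first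
  order gives \<open>\<Delta>z\<^sub>k\<^sub>+\<^sub>1 = -(I - L\<^sub>\<star>)e\<^sub>k + O(\<xi>\<^sub>k) + o(e\<^sub>k)\<close>; since \<open>\<xi>\<^sub>k = o(\<Delta>z\<^sub>k\<^sub>+\<^sub>1)\<close>, the error
  \<open>\<xi>\<^sub>k\<close> is absorbed and equals \<open>o(e\<^sub>k)\<close>. Hence
  \<open>d\<^sub>k\<^sub>+\<^sub>1 = \<xi>\<^sub>k - (p\<^sub>k\<^sub>+\<^sub>1 - p\<^sub>k) = S(I - L\<^sub>\<star>)e\<^sub>k + o(e\<^sub>k)\<close>, and nondegeneracy of \<open>I - L\<^sub>\<star>\<close> along
  \<open>e\<^sub>k\<close> makes \<open>e\<^sub>k = O(d\<^sub>k\<^sub>+\<^sub>1)\<close>. Replacing \<open>e\<^sub>k\<close> by its nearest point of \<open>U\<close> costs \<open>o(e\<^sub>k)\<close>, so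
  \<open>d\<^sub>k\<^sub>+\<^sub>1\<close> is within \<open>o(d\<^sub>k\<^sub>+\<^sub>1)\<close> of \<open>V\<close>.
\<close>

section \<open>Little-o estimates and distances to a subspace\<close>

lemma smallo_eventually_le:
  fixes f g h :: "'b \<Rightarrow> real"
  assumes "g \<in> o[F](h)" and "\<forall>\<^sub>F k in F. \<bar>f k\<bar> \<le> g k"
  shows "f \<in> o[F](h)"
proof -
  have "f \<in> O[F](g)"
    by (rule bigoI[of _ 1]) (use assms(2) in \<open>auto elim: eventually_mono\<close>)
  then show ?thesis using assms(1) by (rule landau_o.big_small_trans)
qed

text \<open>The epsilon form of the derivative has no quotient, so \<open>y k = x\<close> is
  allowed. This matters for the argument of \<open>Pg\<close> below, which may coincide with its
  limit.\<close>

lemma has_derivative_imp_smallo: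
  fixes P :: "'a::real_normed_vector \<Rightarrow> 'b::real_normed_vector"
  assumes "(P has_derivative P') (at x)" and "(y \<longlongrightarrow> x) F"
  shows "(\<lambda>k. norm (P (y k) - P x - P' (y k - x))) \<in> o[F](\<lambda>k. norm (y k - x))"
proof (rule landau_o.smallI)
  fix c :: real assume "c > 0"
  then obtain r where "r > 0"
    and r: "\<And>v. norm (v - x) < r \<Longrightarrow> norm (P v - P x - P' (v - x)) \<le> c * norm (v - x)"
    using assms(1) unfolding has_derivative_at_alt by blast
  from assms(2) \<open>r > 0\<close> have "\<forall>\<^sub>F k in F. norm (y k - x) < r"
    by (auto simp: tendsto_iff dist_norm)
  then show "\<forall>\<^sub>F k in F. norm (norm (P (y k) - P x - P' (y k - x))) \<le> c * norm (norm (y k - x))"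
    by eventually_elim (use r in auto)
qed

text \<open>\<open>M\<close> sends a nearest point of \<open>U\<close> to a point of the image at
  distance \<open>o(norm (e k))\<close> from \<open>d k\<close>. The lower bound on \<open>M\<close>
  along \<open>e\<close> turns this into \<open>o(norm (d k))\<close>.\<close>

lemma infdist_ratio_linear_image:
  fixes M :: "'a::euclidean_space \<Rightarrow> 'a" and e d :: "nat \<Rightarrow> 'a"
  assumes "subspace U" and M: "bounded_linear M" and e0: "\<And>k. e k \<noteq> 0"
    and U: "(\<lambda>k. infdist (e k) U / norm (e k)) \<longlonglongrightarrow> 0"
    and d: "(\<lambda>k. norm (d k - M (e k))) \<in> o(\<lambda>k. norm (e k))"
    and c: "0 < c" "\<forall>\<^sub>F k in sequentially. c * norm (e k) \<le> norm (M (e k))"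
  shows "(\<lambda>k. infdist (d k) (M ` U) / norm (d k)) \<longlonglongrightarrow> 0"
proof -
  obtain K where K: "\<And>v. norm (M v) \<le> norm v * K"
    using bounded_linear.nonneg_bounded[OF M] by blast
  \<comment> \<open>The error uses up at most half of the lower bound \<open>c\<close>; the other
    half survives for \<open>d k\<close> and gives \<open>e = O(d)\<close>.\<close>
  have "\<forall>\<^sub>F k in sequentially. norm (d k - M (e k)) \<le> c / 2 * norm (e k)"
    using landau_o.smallD[OF d, of "c / 2"] c(1) by simp
  with c(2) have "\<forall>\<^sub>F k in sequentially. norm (norm (e k)) \<le> 2 / c * norm (norm (d k))"
  proof eventually_elim
    case (elim k)
    have "norm (M (e k)) \<le> norm (d k) + norm (d k - M (e k))"
      using norm_triangle_ineq4[of "d k" "d k - M (e k)"] by simp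
    with elim have "c / 2 * norm (e k) \<le> norm (d k)" by simp
    then show ?case using c(1) by (simp add: field_simps)
  qed
  then have ed: "(\<lambda>k. norm (e k)) \<in> O(\<lambda>k. norm (d k))" by (rule bigoI)
  \<comment> \<open>Subspaces are closed in finite dimension, so the distance to \<open>U\<close> is
    attained.\<close>
  have "closed U" "U \<noteq> {}"
    using \<open>subspace U\<close> closed_subspace subspace_0 by auto
  then have "\<exists>u\<in>U. infdist (e k) U = dist (e k) u" for k
    using infdist_attains_inf[OF \<open>closed U\<close> \<open>U \<noteq> {}\<close>, of "e k"] by blast
  then obtain u where u: "\<And>k. u k \<in> U" "\<And>k. infdist (e k) U = norm (e k - u k)"
    unfolding dist_norm by metis
  have uo: "(\<lambda>k. norm (e k - u k)) \<in> o(\<lambda>k. norm (e k))"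
    using U e0 unfolding u(2) by (intro smalloI_tendsto) auto
  have "(\<lambda>k. norm (d k - M (e k)) + K * norm (e k - u k)) \<in> o(\<lambda>k. norm (e k))"
    by (intro sum_in_smallo d) (use uo in \<open>cases "K = 0"; simp\<close>)
  moreover have "infdist (d k) (M ` U) \<le> norm (d k - M (e k)) + K * norm (e k - u k)" for k
  proof -
    have "infdist (d k) (M ` U) \<le> norm (d k - M (u k))"
      using infdist_le[of "M (u k)" "M ` U" "d k"] u(1) by (simp add: dist_norm)
    also have "d k - M (u k) = (d k - M (e k)) + M (e k - u k)"
      by (simp add: bounded_linear.linear[OF M] linear_diff)
    also have "norm \<dots> \<le> norm (d k - M (e k)) + K * norm (e k - u k)"
      using norm_triangle_ineq[of "d k - M (e k)" "M (e k - u k)"] K[of "e k - u k"]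
      by (simp add: mult.commute)
    finally show ?thesis .
  qed
  ultimately have "(\<lambda>k. infdist (d k) (M ` U)) \<in> o(\<lambda>k. norm (e k))"
    by (elim smallo_eventually_le) (simp add: infdist_nonneg)
  from landau_o.small_big_trans[OF this ed] show ?thesis by (rule smalloD_tendsto)
qed

section \<open>First-order expansion of the inexact iteration\<close>

text \<open>This form mirrors the update rule: L - I is 2\<alpha> times the linearization of u ->
  P_g(2 P_f u - u) - P_f u, so an inexact step can be compared with it term by term.\<close>

lemma drs_deriv_eq:
  "drs_deriv \<alpha> G Q h = h + (2 * \<alpha>) *\<^sub>R
    (Q (2 *\<^sub>R inv (blinfun_apply G) h - h) - inv (blinfun_apply G) h)"
proof -
  have "(1 - \<alpha>) *\<^sub>R h + \<alpha> *\<^sub>R (2 *\<^sub>R q - (2 *\<^sub>R s - h)) = h + (2 * \<alpha>) *\<^sub>R (q - s)" for q s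
    by (simp add: algebra_simps)
  then show ?thesis unfolding drs_deriv_def Let_def .
qed

text \<open>The paper's \<open>d\<^sub>k\<^sub>+\<^sub>1\<close> is \<open>x k - Pf (z (Suc k))\<close>.\<close>

lemma inexact_drs_direction:
  fixes Pf Pg S Q :: "'a::euclidean_space \<Rightarrow> 'a" and x z :: "nat \<Rightarrow> 'a"
  assumes Pf: "(Pf has_derivative S) (at z\<^sub>0)"
    and Pg: "(Pg has_derivative Q) (at (2 *\<^sub>R Pf z\<^sub>0 - z\<^sub>0))"
    and fixp: "Pg (2 *\<^sub>R Pf z\<^sub>0 - z\<^sub>0) = Pf z\<^sub>0"
    and step: "\<And>k. z (Suc k) = z k + (2 * \<alpha>) *\<^sub>R (Pg (2 *\<^sub>R x k - z k) - x k)"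
    and z: "z \<longlonglongrightarrow> z\<^sub>0" and x: "x \<longlonglongrightarrow> Pf z\<^sub>0"
    and err: "(\<lambda>k. norm (x k - Pf (z k))) \<in> o(\<lambda>k. norm (z (Suc k) - z k))"
  defines "L \<equiv> \<lambda>h. h + (2 * \<alpha>) *\<^sub>R (Q (2 *\<^sub>R S h - h) - S h)"
  shows "(\<lambda>k. norm (x k - Pf (z (Suc k)) - S ((z k - z\<^sub>0) - L (z k - z\<^sub>0))))
    \<in> o(\<lambda>k. norm (z k - z\<^sub>0))"
proof -
  define e where "e k = z k - z\<^sub>0" for k
  define \<xi> where "\<xi> k = x k - Pf (z k)" for k
  \<comment> \<open>\<open>r\<close> and \<open>\<rho>\<close> are the first-order remainders of
    \<open>Pf\<close> at \<open>z k\<close> and of \<open>Pg\<close> at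
    \<open>2 *\<^sub>R x k - z k\<close>, where \<open>q\<close> is the displacement of the latter
    argument. In \<open>\<rho>\<close>, the value of \<open>Pg\<close> at the base point is written
    as \<open>Pf z\<^sub>0\<close> by \<open>fixp\<close>.\<close>
  define r where "r k = Pf (z k) - Pf z\<^sub>0 - S (e k)" for k
  define q where "q k = 2 *\<^sub>R x k - z k - (2 *\<^sub>R Pf z\<^sub>0 - z\<^sub>0)" for k
  define \<rho> where "\<rho> k = Pg (2 *\<^sub>R x k - z k) - Pf z\<^sub>0 - Q (q k)" for k
  define \<Delta> where "\<Delta> k = z (Suc k) - z k" for k
  note lin = bounded_linear.linear[OF has_derivative_bounded_linear[OF Pf]]
    bounded_linear.linear[OF has_derivative_bounded_linear[OF Pg]]
  obtain KS where KS: "KS > 0" "\<And>v. norm (S v) \<le> KS * norm v"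
    using bounded_linear.pos_bounded[OF has_derivative_bounded_linear[OF Pf]]
    by (metis mult.commute)
  obtain KQ where KQ: "KQ > 0" "\<And>v. norm (Q v) \<le> KQ * norm v"
    using bounded_linear.pos_bounded[OF has_derivative_bounded_linear[OF Pg]]
    by (metis mult.commute)

  have ro: "(\<lambda>k. norm (r k)) \<in> o(\<lambda>k. norm (e k))"
    unfolding r_def e_def using Pf z by (rule has_derivative_imp_smallo)
  have "(\<lambda>k. 2 *\<^sub>R x k - z k) \<longlonglongrightarrow> 2 *\<^sub>R Pf z\<^sub>0 - z\<^sub>0"
    by (intro tendsto_intros z x)
  from has_derivative_imp_smallo[OF Pg this]
  have \<rho>o: "(\<lambda>k. norm (\<rho> k)) \<in> o(\<lambda>k. norm (q k))"
    unfolding \<rho>_def q_def fixp .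
  have \<xi>o: "(\<lambda>k. norm (\<xi> k)) \<in> o(\<lambda>k. norm (\<Delta> k))"
    using err by (simp add: \<xi>_def \<Delta>_def)

  have q_eq: "q k = 2 *\<^sub>R \<xi> k + 2 *\<^sub>R r k + (2 *\<^sub>R S (e k) - e k)" for k
    by (simp add: q_def \<xi>_def r_def e_def algebra_simps)
  \<comment> \<open>\<open>s\<close> collects what \<Delta> contains beyond -(e - L e): the prox
    error \<xi> and the two remainders, all to be shown o(e).\<close>
  define s where "s k = (2 * \<alpha>) *\<^sub>R (Q (2 *\<^sub>R \<xi> k + 2 *\<^sub>R r k) - \<xi> k - r k + \<rho> k)" for k
  have \<Delta>_eq: "\<Delta> k = s k - (e k - L (e k))" for k
  proof -
    have "\<Delta> k = (2 * \<alpha>) *\<^sub>R (Q (q k) + \<rho> k - (x k - Pf z\<^sub>0))"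
      by (simp add: \<Delta>_def step \<rho>_def)
    also have "x k - Pf z\<^sub>0 = \<xi> k + r k + S (e k)"
      by (simp add: \<xi>_def r_def)
    also have "Q (q k) = Q (2 *\<^sub>R \<xi> k + 2 *\<^sub>R r k) + Q (2 *\<^sub>R S (e k) - e k)"
      unfolding q_eq using linear_add[OF lin(2)] .
    finally show ?thesis by (simp add: s_def L_def algebra_simps)
  qed
  have q_le: "norm (q k) \<le> 2 * norm (\<xi> k) + 2 * norm (r k) + (2 * KS + 1) * norm (e k)" for k
  proof -
    have "norm (q k) \<le> norm (2 *\<^sub>R \<xi> k) + norm (2 *\<^sub>R r k) + (norm (2 *\<^sub>R S (e k)) + norm (e k))"
      unfolding q_eq by (intro norm_triangle_mono norm_triangle_ineq4 order_refl)
    then show ?thesis using KS(2)[of "e k"] by (simp add: algebra_simps)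
  qed
  \<comment> \<open>Inside \<open>s\<close>, \<xi> and \<open>r\<close> enter once directly and once
    doubled through \<open>Q\<close>, giving \<open>2 * KQ + 1\<close>; the prefactor of
    \<open>s\<close> contributes \<open>2 * \<bar>\<alpha>\<bar>\<close>.\<close>
  define C where "C = 2 * \<bar>\<alpha>\<bar> * (2 * KQ + 1)"
  have s_le: "norm (s k) \<le> C * norm (\<xi> k) + C * norm (r k) + 2 * \<bar>\<alpha>\<bar> * norm (\<rho> k)" for k
  proof -
    have "norm (Q (2 *\<^sub>R \<xi> k + 2 *\<^sub>R r k)) \<le> KQ * (2 * norm (\<xi> k) + 2 * norm (r k))"
      using KQ(1) norm_triangle_ineq[of "2 *\<^sub>R \<xi> k" "2 *\<^sub>R r k"]
      by (intro order_trans[OF KQ(2)] mult_left_mono) auto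
    moreover have "norm (Q (2 *\<^sub>R \<xi> k + 2 *\<^sub>R r k) - \<xi> k - r k + \<rho> k)
      \<le> norm (Q (2 *\<^sub>R \<xi> k + 2 *\<^sub>R r k)) + norm (\<xi> k) + norm (r k) + norm (\<rho> k)"
      by norm
    ultimately have "norm (Q (2 *\<^sub>R \<xi> k + 2 *\<^sub>R r k) - \<xi> k - r k + \<rho> k)
      \<le> (2 * KQ + 1) * norm (\<xi> k) + (2 * KQ + 1) * norm (r k) + norm (\<rho> k)"
      by (simp add: algebra_simps)
    then have "norm (s k)
      \<le> 2 * \<bar>\<alpha>\<bar> * ((2 * KQ + 1) * norm (\<xi> k) + (2 * KQ + 1) * norm (r k) + norm (\<rho> k))"
      unfolding s_def norm_scaleR by (simp add: abs_mult mult_left_mono)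
    then show ?thesis by (simp add: C_def algebra_simps)
  qed
  have IL_le: "norm (e k - L (e k)) \<le> 2 * \<bar>\<alpha>\<bar> * (KQ * (2 * KS + 1) + KS) * norm (e k)" for k
  proof -
    have "norm (2 *\<^sub>R S (e k) - e k) \<le> (2 * KS + 1) * norm (e k)"
      using norm_triangle_ineq4[of "2 *\<^sub>R S (e k)" "e k"] KS(2)[of "e k"]
      by (simp add: algebra_simps)
    then have "norm (Q (2 *\<^sub>R S (e k) - e k)) \<le> KQ * ((2 * KS + 1) * norm (e k))"
      using KQ(1) by (intro order_trans[OF KQ(2)] mult_left_mono) auto
    then have "norm (Q (2 *\<^sub>R S (e k) - e k) - S (e k)) \<le> (KQ * (2 * KS + 1) + KS) * norm (e k)"
      using norm_triangle_ineq4[of "Q (2 *\<^sub>R S (e k) - e k)" "S (e k)"] KS(2)[of "e k"]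
      by (simp add: algebra_simps)
    then show ?thesis by (simp add: L_def abs_mult mult_left_mono mult.assoc)
  qed

  \<comment> \<open>\<open>C1\<close> is the total coefficient of \<xi> in the bound on \<Delta>:
    \<open>C\<close> from \<open>s\<close>, and \<open>4 * \<bar>\<alpha>\<bar>\<close> from
    bounding \<rho> by \<open>q\<close>, which contains 2\<xi>. \<open>C2\<close> is the coefficient
    of \<open>e\<close>: \<open>r\<close> is bounded by \<open>e\<close> at the same cost
    \<open>C1\<close>, and the rest comes from the \<open>e\<close> part of \<open>q\<close> and
    from \<open>IL_le\<close>.\<close>
  define C1 where "C1 = C + 4 * \<bar>\<alpha>\<bar>"
  define C2 where "C2 = C1 + 2 * \<bar>\<alpha>\<bar> * (2 * KS + 1) + 2 * \<bar>\<alpha>\<bar> * (KQ * (2 * KS + 1) + KS)"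
  have "C1 \<ge> 0" unfolding C1_def C_def using KQ(1) by simp
  \<comment> \<open>\<xi> is small only relative to \<Delta>, whose bound in turn involves \<xi>.
    The chosen factor makes \<open>C1 * norm (\<xi> k)\<close> at most half of
    \<open>norm (\<Delta> k)\<close>, which the left side absorbs; the \<open>+ 1\<close> covers
    \<open>C1 = 0\<close>.\<close>
  have "\<forall>\<^sub>F k in sequentially. norm (r k) \<le> norm (e k)"
    "\<forall>\<^sub>F k in sequentially. norm (\<rho> k) \<le> norm (q k)"
    "\<forall>\<^sub>F k in sequentially. norm (\<xi> k) \<le> 1 / (2 * (C1 + 1)) * norm (\<Delta> k)"
    using landau_o.smallD[OF ro, of 1] landau_o.smallD[OF \<rho>o, of 1]
      landau_o.smallD[OF \<xi>o, of "1 / (2 * (C1 + 1))"] \<open>C1 \<ge> 0\<close> by simp_all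
  then have "\<forall>\<^sub>F k in sequentially. norm (norm (\<Delta> k)) \<le> 2 * C2 * norm (norm (e k))"
  proof eventually_elim
    case (elim k)
    have "C * norm (r k) + 4 * \<bar>\<alpha>\<bar> * norm (r k) \<le> C1 * norm (e k)"
      using elim(1) \<open>C1 \<ge> 0\<close> mult_left_mono[of "norm (r k)" "norm (e k)" C1]
      by (simp add: C1_def algebra_simps)
    moreover have "2 * \<bar>\<alpha>\<bar> * norm (\<rho> k)
      \<le> 2 * \<bar>\<alpha>\<bar> * (2 * norm (\<xi> k) + 2 * norm (r k) + (2 * KS + 1) * norm (e k))"
      using elim(2) q_le[of k] by (intro mult_left_mono) auto
    moreover have "norm (\<Delta> k) \<le> norm (s k) + norm (e k - L (e k))"
      unfolding \<Delta>_eq by (rule norm_triangle_ineq4)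
    ultimately have "norm (\<Delta> k) \<le> C1 * norm (\<xi> k) + C2 * norm (e k)"
      using s_le[of k] IL_le[of k] by (simp add: C1_def C2_def algebra_simps)
    moreover have "C1 * norm (\<xi> k) \<le> norm (\<Delta> k) / 2"
    proof -
      have "(C1 + 1) * norm (\<xi> k) \<le> norm (\<Delta> k) / 2"
        using elim(3) \<open>C1 \<ge> 0\<close> by (simp add: field_simps)
      then show ?thesis using norm_ge_zero[of "\<xi> k"] by (simp only: distrib_right)
    qed
    ultimately show ?case by simp
  qed
  then have \<Delta>O: "(\<lambda>k. norm (\<Delta> k)) \<in> O(\<lambda>k. norm (e k))" by (rule bigoI)
  have \<xi>e: "(\<lambda>k. norm (\<xi> k)) \<in> o(\<lambda>k. norm (e k))"
    using \<xi>o \<Delta>O by (rule landau_o.small_big_trans)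
  have cm: "(\<lambda>k. c * v k) \<in> o(\<lambda>k. norm (e k))" if "v \<in> o(\<lambda>k. norm (e k))" for c v
    using that by (cases "c = 0") simp_all
  \<comment> \<open>\<rho> is so far only o(q); now that \<xi> and \<open>r\<close> are o(e),
    \<open>q\<close> is O(e) and \<rho> becomes o(e).\<close>
  have "(\<lambda>k. norm (q k)) \<in> O(\<lambda>k. norm (e k))"
  proof -
    have "(\<lambda>k. 2 * norm (\<xi> k) + 2 * norm (r k) + (2 * KS + 1) * norm (e k)) \<in> O(\<lambda>k. norm (e k))"
      by (intro sum_in_bigo landau_o.small_imp_big[OF cm[OF \<xi>e]]
          landau_o.small_imp_big[OF cm[OF ro]]) simp
    moreover have "(\<lambda>k. norm (q k))
      \<in> O(\<lambda>k. 2 * norm (\<xi> k) + 2 * norm (r k) + (2 * KS + 1) * norm (e k))"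
      by (rule bigoI[of _ 1]) (use q_le KS(1) in auto)
    ultimately show ?thesis by (rule landau_o.big_trans[rotated])
  qed
  with \<rho>o have \<rho>e: "(\<lambda>k. norm (\<rho> k)) \<in> o(\<lambda>k. norm (e k))"
    by (rule landau_o.small_big_trans)
  have se: "(\<lambda>k. norm (s k)) \<in> o(\<lambda>k. norm (e k))"
  proof (rule smallo_eventually_le)
    show "(\<lambda>k. C * norm (\<xi> k) + C * norm (r k) + 2 * \<bar>\<alpha>\<bar> * norm (\<rho> k)) \<in> o(\<lambda>k. norm (e k))"
      by (intro sum_in_smallo cm \<xi>e ro \<rho>e)
  qed (use s_le in simp)
  \<comment> \<open>The remainder at the next iterate is small against \<open>e (Suc k)\<close>;
    this comparison makes it small against \<open>e k\<close>.\<close>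
  have "(\<lambda>k. norm (e (Suc k))) \<in> O(\<lambda>k. norm (e k))"
  proof -
    have "(\<lambda>k. norm (e k) + norm (\<Delta> k)) \<in> O(\<lambda>k. norm (e k))"
      by (intro sum_in_bigo \<Delta>O) simp
    moreover have "e (Suc k) = e k + \<Delta> k" for k by (simp add: e_def \<Delta>_def)
    then have "(\<lambda>k. norm (e (Suc k))) \<in> O(\<lambda>k. norm (e k) + norm (\<Delta> k))"
      by (intro bigoI[of _ 1]) (simp_all add: norm_triangle_ineq always_eventually)
    ultimately show ?thesis by (rule landau_o.big_trans[rotated])
  qed
  moreover have "(\<lambda>k. norm (r (Suc k))) \<in> o(\<lambda>k. norm (e (Suc k)))"
    using landau_o.small.compose[OF ro filterlim_Suc] .
  ultimately have rSuc: "(\<lambda>k. norm (r (Suc k))) \<in> o(\<lambda>k. norm (e k))"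
    by (rule landau_o.small_big_trans[rotated])
  \<comment> \<open>\<open>Pf\<close> is differentiated only at \<open>z\<^sub>0\<close>, so both
    \<open>Pf (z k)\<close> and \<open>Pf (z (Suc k))\<close> are expanded there, and
    \<open>S (\<Delta> k)\<close> is computed in two ways.\<close>
  have eq: "x k - Pf (z (Suc k)) - S (e k - L (e k)) = \<xi> k + r k - r (Suc k) - S (s k)" for k
  proof -
    have "S (\<Delta> k) = S (e (Suc k)) - S (e k)"
      using linear_diff[OF lin(1), of "e (Suc k)" "e k"] by (simp add: \<Delta>_def e_def)
    moreover have "S (\<Delta> k) = S (s k) - S (e k - L (e k))"
      unfolding \<Delta>_eq using linear_diff[OF lin(1)] .
    ultimately have "S (e k - L (e k)) = S (s k) - S (e (Suc k)) + S (e k)"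
      by (simp add: algebra_simps)
    then show ?thesis by (simp add: \<xi>_def r_def)
  qed
  have "(\<lambda>k. norm (x k - Pf (z (Suc k)) - S (e k - L (e k)))) \<in> o(\<lambda>k. norm (e k))"
  proof (rule smallo_eventually_le)
    show "(\<lambda>k. norm (\<xi> k) + norm (r k) + norm (r (Suc k)) + KS * norm (s k)) \<in> o(\<lambda>k. norm (e k))"
      by (intro sum_in_smallo cm \<xi>e ro rSuc se)
    have "norm (\<xi> k + r k - r (Suc k) - S (s k))
      \<le> norm (\<xi> k) + norm (r k) + norm (r (Suc k)) + KS * norm (s k)" for k
    proof -
      have "norm (\<xi> k + r k - r (Suc k) - S (s k))
        \<le> norm (\<xi> k) + norm (r k) + norm (r (Suc k)) + norm (S (s k))" by norm
      then show ?thesis using KS(2)[of "s k"] by linarith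
    qed
    then show "\<forall>\<^sub>F k in sequentially. \<bar>norm (x k - Pf (z (Suc k)) - S (e k - L (e k)))\<bar>
      \<le> norm (\<xi> k) + norm (r k) + norm (r (Suc k)) + KS * norm (s k)"
      unfolding eq by simp
  qed
  then show ?thesis by (simp only: e_def)
qed

section \<open>Orthogonal projection and distance\<close>

text \<open>The description by \<open>THE\<close> has a unique solution: two candidates differ by a
  vector of \<open>V\<close> orthogonal to itself. Uniqueness also yields linearity, so that
  \<open>Blinfun\<close> returns the intended map.\<close>

lemma orth_proj:
  fixes V :: "'a::euclidean_space set"
  assumes V: "subspace V"
  shows "blinfun_apply (orth_proj V) x \<in> V"
    and "v \<in> V \<Longrightarrow> inner (x - blinfun_apply (orth_proj V) x) v = 0"
proof -
  let ?P = "\<lambda>x y. y \<in> V \<and> (\<forall>v\<in>V. inner (x - y) v = 0)"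
  have ex: "\<exists>y. ?P x y" for x
  proof -
    obtain y w where "y \<in> span V" "\<And>v. v \<in> span V \<Longrightarrow> orthogonal w v" "x = y + w"
      using orthogonal_subspace_decomp_exists by blast
    then show ?thesis
      using V by (intro exI[of _ y]) (auto simp: span_eq_iff[THEN iffD2] orthogonal_def)
  qed
  have uni: "y = y'" if "?P x y" "?P x y'" for x y y'
  proof -
    have "y - y' \<in> V" using that V by (simp add: subspace_diff)
    then have "inner (x - y') (y - y') - inner (x - y) (y - y') = 0" using that by simp
    then have "inner (y - y') (y - y') = 0" by (simp add: inner_diff_left)
    then show ?thesis by simp
  qed
  define \<pi> where "\<pi> x = (THE y. ?P x y)" for x
  have \<pi>: "?P x (\<pi> x)" for x
    unfolding \<pi>_def by (rule theI', rule ex_ex1I[OF ex]) (rule uni)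
  have "linear \<pi>"
  proof (rule linearI)
    fix b1 b2 :: 'a
    show "\<pi> (b1 + b2) = \<pi> b1 + \<pi> b2"
      using \<pi>[of b1] \<pi>[of b2] V
      by (intro uni[OF \<pi>]) (auto simp: subspace_add algebra_simps)
  next
    fix c :: real and b :: 'a
    show "\<pi> (c *\<^sub>R b) = c *\<^sub>R \<pi> b"
      using \<pi>[of b] V
      by (intro uni[OF \<pi>]) (auto simp: subspace_scale inner_diff_left)
  qed
  then have "bounded_linear \<pi>" by (simp add: linear_conv_bounded_linear)
  then have "blinfun_apply (orth_proj V) = \<pi>"
    unfolding orth_proj_def \<pi>_def[abs_def] by (rule bounded_linear_Blinfun_apply)
  then show "blinfun_apply (orth_proj V) x \<in> V"
    and "v \<in> V \<Longrightarrow> inner (x - blinfun_apply (orth_proj V) x) v = 0"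
    using \<pi>[of x] by auto
qed

text \<open>Pythagoras: the residual is orthogonal to the difference of the projection and any point
  of \<open>V\<close>.\<close>

lemma norm_diff_orth_proj_le_infdist:
  fixes V :: "'a::euclidean_space set"
  assumes V: "subspace V"
  shows "norm (x - blinfun_apply (orth_proj V) x) \<le> infdist x V"
proof -
  let ?y = "blinfun_apply (orth_proj V) x"
  have "norm (x - ?y) \<le> dist x v" if "v \<in> V" for v
  proof -
    have "?y - v \<in> V" using that orth_proj(1)[OF V] V by (simp add: subspace_diff)
    then have "orthogonal (x - ?y) (?y - v)"
      using orth_proj(2)[OF V] by (simp add: orthogonal_def)
    then have "(norm (x - v))\<^sup>2 = (norm (x - ?y))\<^sup>2 + (norm (?y - v))\<^sup>2"
      using norm_add_Pythagorean by force
    then have "(norm (x - ?y))\<^sup>2 \<le> (norm (x - v))\<^sup>2" by simp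
    then show ?thesis unfolding dist_norm by (rule power2_le_imp_le) simp
  qed
  moreover have "V \<noteq> {}" using V subspace_0 by auto
  ultimately show ?thesis by (auto simp: infdist_def intro!: cINF_greatest)
qed

section \<open>Hessians of the proximal objectives and their segment averages\<close>

lemma grad_eqI:
  assumes "GDERIV f x :> D"
  shows "grad f x = D"
proof -
  have "f differentiable (at x)" using assms by (auto simp: gderiv_def differentiable_def)
  from grad_GDERIV[OF this] assms
  have "(\<lambda>h. inner h (grad f x)) = (\<lambda>h. inner h D)"
    unfolding gderiv_def by (rule has_derivative_unique)
  then have "inner (grad f x - D) (grad f x) = inner (grad f x - D) D" by meson
  then have "inner (grad f x - D) (grad f x - D) = 0" by (simp add: inner_diff_right)
  then show ?thesis by simp
qed

text \<open>The quadratic term contributes the identity whatever its centre \<open>u\<close>, so all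
  \<phi>_k have the same Hessian field.\<close>

lemma hess_prox_objective:
  fixes f :: "'a::euclidean_space \<Rightarrow> real"
  assumes "twice_continuously_differentiable f"
  shows "hess (\<lambda>y. \<gamma> * f y + 1/2 * (norm (y - u))\<^sup>2) x = id_blinfun + \<gamma> *\<^sub>R hess f x"
proof -
  let ?\<phi> = "\<lambda>y. \<gamma> * f y + 1/2 * (norm (y - u))\<^sup>2"
  have df: "\<And>y. f differentiable (at y)" and dg: "\<And>y. grad f differentiable (at y)"
    using assms by (auto simp: twice_continuously_differentiable_def)
  have "grad ?\<phi> = (\<lambda>y. \<gamma> *\<^sub>R grad f y + (y - u))"
  proof
    fix y
    have gd: "(f has_derivative (\<lambda>h. inner h (grad f y))) (at y)"
      using grad_GDERIV[OF df] by (simp add: gderiv_def)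
    have "(?\<phi> has_derivative (\<lambda>h. inner h (\<gamma> *\<^sub>R grad f y + (y - u)))) (at y)"
      unfolding power2_norm_eq_inner
      by (rule derivative_eq_intros gd refl | simp add: fun_eq_iff algebra_simps inner_commute)+
    then show "grad ?\<phi> y = \<gamma> *\<^sub>R grad f y + (y - u)"
      by (intro grad_eqI) (simp add: gderiv_def)
  qed
  moreover have "((\<lambda>y. \<gamma> *\<^sub>R grad f y + (y - u)) has_derivative
      blinfun_apply (id_blinfun + \<gamma> *\<^sub>R hess f x)) (at x)"
    by (rule derivative_eq_intros hess_has_derivative[OF dg] refl
        | simp add: fun_eq_iff blinfun.add_left blinfun.scaleR_left)+
  ultimately have "frechet_derivative (grad ?\<phi>) (at x) = blinfun_apply (id_blinfun + \<gamma> *\<^sub>R hess f x)"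
    by (simp add: frechet_derivative_at[symmetric])
  then show ?thesis unfolding hess_def[of ?\<phi>] by (simp add: blinfun_apply_inverse)
qed

text \<open>The segments shrink to \<open>p\<^sub>0\<close>, so continuity at that point makes the
  integrand uniformly close to \<open>H p\<^sub>0\<close>.\<close>

lemma integral_segment_tendsto:
  fixes H :: "'a::euclidean_space \<Rightarrow> 'b::banach"
  assumes H: "continuous_on UNIV H" and p: "p \<longlonglongrightarrow> p\<^sub>0" and d: "d \<longlonglongrightarrow> 0"
  shows "(\<lambda>k. integral {0..1} (\<lambda>t. H (p k + t *\<^sub>R d k))) \<longlonglongrightarrow> H p\<^sub>0"
proof (rule tendstoI)
  fix \<epsilon> :: real assume "\<epsilon> > 0"
  \<comment> \<open>The integral bound comes out non-strict, hence
    \<open>\<epsilon> / 2\<close>.\<close>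
  then obtain r where "r > 0" and r: "\<And>y. dist y p\<^sub>0 < r \<Longrightarrow> dist (H y) (H p\<^sub>0) < \<epsilon> / 2"
    using H by (metis UNIV_I continuous_on_iff half_gt_zero)
  have "\<forall>\<^sub>F k in sequentially. dist (p k) p\<^sub>0 < r / 2" "\<forall>\<^sub>F k in sequentially. dist (d k) 0 < r / 2"
    using tendstoD[OF p, of "r / 2"] tendstoD[OF d, of "r / 2"] \<open>r > 0\<close> by simp_all
  then show "\<forall>\<^sub>F k in sequentially. dist (integral {0..1} (\<lambda>t. H (p k + t *\<^sub>R d k))) (H p\<^sub>0) < \<epsilon>"
  proof eventually_elim
    case (elim k)
    let ?h = "\<lambda>t. H (p k + t *\<^sub>R d k)"
    have cont: "continuous_on {0..1} ?h"
      by (intro continuous_on_compose2[OF H] continuous_intros) auto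
    have "norm (?h t - H p\<^sub>0) \<le> \<epsilon> / 2" if "t \<in> {0..1}" for t :: real
    proof -
      have "norm (t *\<^sub>R d k) \<le> norm (d k)" using that by (simp add: mult_left_le_one_le)
      then have "dist (p k + t *\<^sub>R d k) p\<^sub>0 < r"
        using elim norm_triangle_ineq[of "p k - p\<^sub>0" "t *\<^sub>R d k"]
        by (simp add: dist_norm algebra_simps)
      then show ?thesis using r by (force simp: dist_norm)
    qed
    then have "norm (integral {0..1} (\<lambda>t. ?h t - H p\<^sub>0)) \<le> \<epsilon> / 2 * (1 - 0)"
      by (intro integral_bound continuous_intros cont) auto
    moreover have "integral {0..1} (\<lambda>t. ?h t - H p\<^sub>0) = integral {0..1} ?h - H p\<^sub>0"
      by (subst integral_diff) (auto intro: integrable_continuous_real cont)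
    ultimately show ?case using \<open>\<epsilon> > 0\<close> by (simp add: dist_norm)
  qed
qed

section \<open>The Dennis-More limit\<close>

text \<open>Split (B - Gbar)d into (B - G) on the projection of d, (B - G) on the residual, and
  -(Gbar - G)d. The hypothesis \<open>BV\<close> controls \<open>B\<close> only on \<open>V\<close>;
  on the residual, which is o(d), boundedness of \<open>B\<close> suffices.\<close>

lemma dennis_more_of_subspace:
  fixes B Gbar :: "nat \<Rightarrow> 'a::euclidean_space \<Rightarrow>\<^sub>L 'a"
  assumes V: "subspace V" and dV: "(\<lambda>k. infdist (d k) V / norm (d k)) \<longlonglongrightarrow> 0"
    and G: "Gbar \<longlonglongrightarrow> G" and B: "bounded (range B)"
    and BV: "(\<lambda>k. norm ((B k - G) o\<^sub>L orth_proj V)) \<longlonglongrightarrow> 0"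
  shows "(\<lambda>k. norm (blinfun_apply (B k - Gbar k) (d k)) / norm (d k)) \<longlonglongrightarrow> 0"
proof -
  obtain K where K: "\<And>k. norm (B k) \<le> K" using B by (auto simp: bounded_iff)
  then have "0 \<le> K" using norm_ge_zero order_trans by blast
  let ?b = "\<lambda>k. norm ((B k - G) o\<^sub>L orth_proj V) + (K + norm G) * (infdist (d k) V / norm (d k))
    + norm (Gbar k - G)"
  have b_lim: "?b \<longlonglongrightarrow> 0 + (K + norm G) * 0 + 0"
    by (intro tendsto_add tendsto_mult tendsto_const BV dV)
      (use G in \<open>simp add: LIM_zero_iff tendsto_norm_zero_iff\<close>)
  have b_le: "norm (blinfun_apply (B k - Gbar k) (d k)) / norm (d k) \<le> ?b k" for k
  \<comment> \<open>Division by zero gives 0, so both quotients vanish in the first case.\<close>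
  proof (cases "d k = 0")
    case True
    then show ?thesis using \<open>0 \<le> K\<close> by simp
  next
    case False
    let ?y = "blinfun_apply (orth_proj V) (d k)"
    have eq: "blinfun_apply (B k - Gbar k) (d k) = blinfun_apply ((B k - G) o\<^sub>L orth_proj V) (d k)
      + blinfun_apply (B k - G) (d k - ?y) - blinfun_apply (Gbar k - G) (d k)"
      by (simp add: blinfun.diff_left blinfun.diff_right)
    have "norm (blinfun_apply (B k - Gbar k) (d k))
      \<le> norm (blinfun_apply ((B k - G) o\<^sub>L orth_proj V) (d k))
      + norm (blinfun_apply (B k - G) (d k - ?y)) + norm (blinfun_apply (Gbar k - G) (d k))"
      unfolding eq
      by (rule order_trans[OF norm_triangle_ineq4 add_right_mono[OF norm_triangle_ineq]])
    moreover have "norm (blinfun_apply (B k - G) (d k - ?y)) \<le> (K + norm G) * infdist (d k) V"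
    proof -
      have "norm (B k - G) \<le> K + norm G" using norm_triangle_ineq4[of "B k" G] K[of k] by simp
      then have "norm (B k - G) * norm (d k - ?y) \<le> (K + norm G) * infdist (d k) V"
        using norm_diff_orth_proj_le_infdist[OF V, of "d k"] \<open>0 \<le> K\<close>
        by (intro mult_mono) auto
      then show ?thesis using norm_blinfun order_trans by blast
    qed
    ultimately have "norm (blinfun_apply (B k - Gbar k) (d k))
      \<le> norm ((B k - G) o\<^sub>L orth_proj V) * norm (d k) + (K + norm G) * infdist (d k) V
        + norm (Gbar k - G) * norm (d k)"
      using norm_blinfun[of "(B k - G) o\<^sub>L orth_proj V" "d k"] norm_blinfun[of "Gbar k - G" "d k"]
      by linarith
    then show ?thesis using False by (simp add: field_simps)
  qed
  show ?thesis
  proof (rule Lim_null_comparison[OF always_eventually])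
    show "\<forall>k. norm (norm (blinfun_apply (B k - Gbar k) (d k)) / norm (d k)) \<le> ?b k"
      using b_le by simp
    show "?b \<longlonglongrightarrow> 0"
      using b_lim by simp
  qed
qed

section \<open>Asymptotic directions of the iteration\<close>

theorem proposition5p6:
  fixes f :: "'a::euclidean_space \<Rightarrow> real" and g :: "'a \<Rightarrow> ereal"
    and \<sigma> \<beta> \<gamma> \<alpha> \<delta> c\<^sub>z :: real
    and z_star p_star w_star :: 'a and G_star :: "'a \<Rightarrow>\<^sub>L 'a" and Q_star L_star :: "'a \<Rightarrow> 'a"
    and z x a p \<Delta>z d :: "nat \<Rightarrow> 'a"
    and \<phi> :: "nat \<Rightarrow> 'a \<Rightarrow> real" and Gbar B :: "nat \<Rightarrow> 'a \<Rightarrow>\<^sub>L 'a"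
    and U V :: "'a set"
  assumes "0 < \<sigma>" and "\<sigma> \<le> \<beta>"
    and "convex_on UNIV f" and "twice_continuously_differentiable f"
    and "strongly_convex \<sigma> f" and "smooth \<beta> f"
    and "proper_closed_convex g"
    and "0 < \<gamma>" and "0 < \<alpha>"
    and "\<delta> = max ((\<gamma> * \<beta> - 1) / (\<gamma> * \<beta> + 1)) ((1 - \<gamma> * \<sigma>) / (1 + \<gamma> * \<sigma>))"
    and "\<bar>1 - \<alpha>\<bar> + \<alpha> * \<delta> < 1"
    and "\<And>y. drs_map \<gamma> \<alpha> f g y = y \<longleftrightarrow> y = z_star"
    and "p_star = prox \<gamma> (\<lambda>y. ereal (f y)) z_star" and "w_star = 2 *\<^sub>R p_star - z_star"
    and "G_star = id_blinfun + \<gamma> *\<^sub>R hess f p_star"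
    and "(prox \<gamma> g has_derivative Q_star) (at w_star)"
    and "L_star = drs_deriv \<alpha> G_star Q_star"
    and "\<And>k. z (Suc k) = z k + (2 * \<alpha>) *\<^sub>R (prox \<gamma> g (2 *\<^sub>R x k - z k) - x k)"
    and "\<And>k. p k = prox \<gamma> (\<lambda>y. ereal (f y)) (z k)"
    and "\<And>k. a k = x k"
    and "\<And>k. k \<ge> 1 \<Longrightarrow> \<Delta>z k = z k - z (k - 1)"
    and "\<And>k. k \<ge> 1 \<Longrightarrow> d k = a (k - 1) - p k"
    and "\<And>k. \<phi> k = (\<lambda>y. \<gamma> * f y + 1/2 * (norm (y - z k))\<^sup>2)"
    and "\<And>k. Gbar k = integral {0..1} (\<lambda>t. hess (\<phi> k) (p k + t *\<^sub>R d k))"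
    and "z \<longlonglongrightarrow> z_star" and "\<And>k. z k \<noteq> z_star"
    and "\<And>k. k \<ge> 1 \<Longrightarrow> d k \<noteq> 0" and "d \<longlonglongrightarrow> 0"
    and "(\<lambda>k. a (k - 1)) \<longlonglongrightarrow> p_star" and "p \<longlonglongrightarrow> p_star"
    and "\<And>k. self_adjoint (B k)" and "\<And>k. positive_definite (B k)"
    and "subspace U" and "L_star ` U \<subseteq> U"
    and "(\<lambda>k. infdist (z k - z_star) U / norm (z k - z_star)) \<longlonglongrightarrow> 0"
    and "0 < c\<^sub>z"
    and "\<forall>\<^sub>F k in sequentially.
           norm ((z k - z_star) - L_star (z k - z_star)) \<ge> c\<^sub>z * norm (z k - z_star)"
    and "(\<lambda>k. norm (a (k - 1) - p (k - 1))) \<in> o(\<lambda>k. norm (\<Delta>z k))"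
    and "V = (\<lambda>u. inv (blinfun_apply G_star) (u - L_star u)) ` U"
  shows "(\<lambda>k. infdist (d k) V / norm (d k)) \<longlonglongrightarrow> 0 \<and>
         (bounded (range B) \<longrightarrow>
          (\<lambda>k. norm ((B k - G_star) o\<^sub>L orth_proj V)) \<longlonglongrightarrow> 0 \<longrightarrow>
          (\<lambda>k. norm (blinfun_apply (B k - Gbar k) (d k)) / norm (d k)) \<longlonglongrightarrow> 0)"
proof -
  note cv = assms(3) and c2 = assms(4) and g0 = assms(8) and \<alpha>0 = assms(9)
    and fp = assms(12) and p_star = assms(13) and w_star = assms(14) and G_star = assms(15)
    and Q = assms(16) and L_star = assms(17) and step = assms(18) and p_def = assms(19)
    and a_def = assms(20) and \<Delta>z = assms(21) and d_def = assms(22) and \<phi> = assms(23)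
    and Gbar = assms(24) and z_lim = assms(25) and z_ne = assms(26) and d_lim = assms(28)
    and a_lim = assms(29) and p_lim = assms(30) and U = assms(33) and U_lim = assms(35)
    and cz = assms(36,37) and err = assms(38) and V_def = assms(39)
  let ?Pf = "prox \<gamma> (\<lambda>y. ereal (f y))"
  let ?S = "inv (blinfun_apply G_star)"
  have bij: "bij (blinfun_apply G_star)" and Pf: "(?Pf has_derivative ?S) (at z_star)"
    using prox_has_derivative[OF cv c2 g0, of z_star] by (simp_all add: G_star p_star)
  have linS: "bounded_linear ?S" and linQ: "bounded_linear Q_star"
    using Pf Q has_derivative_bounded_linear by blast+
  have L_eq: "L_star h = h + (2 * \<alpha>) *\<^sub>R (Q_star (2 *\<^sub>R ?S h - h) - ?S h)" for h
    unfolding L_star by (rule drs_deriv_eq)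
  \<comment> \<open>T u - u equals 2\<alpha>(P_g(2 P_f u - u) - P_f u), so a fixed point satisfies
    P_g(w_star) = p_star because \<alpha> is nonzero.\<close>
  have "drs_map \<gamma> \<alpha> f g z_star = z_star" using fp by simp
  then have "(2 * \<alpha>) *\<^sub>R (prox \<gamma> g (2 *\<^sub>R ?Pf z_star - z_star) - ?Pf z_star) = 0"
    by (simp add: drs_map_def refl_prox_def algebra_simps)
  then have fixp: "prox \<gamma> g (2 *\<^sub>R ?Pf z_star - z_star) = ?Pf z_star"
    using \<alpha>0 by simp
  have "(\<lambda>k. norm (x k - ?Pf (z (Suc k)) - ?S ((z k - z_star) - (z k - z_star + (2 * \<alpha>) *\<^sub>R
      (Q_star (2 *\<^sub>R ?S (z k - z_star) - (z k - z_star)) - ?S (z k - z_star))))))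
    \<in> o(\<lambda>k. norm (z k - z_star))"
  proof (rule inexact_drs_direction[OF Pf _ fixp step z_lim])
    show "(prox \<gamma> g has_derivative Q_star) (at (2 *\<^sub>R ?Pf z_star - z_star))"
      using Q by (simp add: w_star p_star)
    show "x \<longlonglongrightarrow> ?Pf z_star"
      using LIMSEQ_Suc[OF a_lim] by (simp add: a_def p_star)
    \<comment> \<open>Shifting the index by one removes \<open>k - 1\<close> and skips index 0,
      where the equations for \<open>\<Delta>z\<close> and \<open>d\<close> do not apply.\<close>
    show "(\<lambda>k. norm (x k - ?Pf (z k))) \<in> o(\<lambda>k. norm (z (Suc k) - z k))"
      using landau_o.small.compose[OF err filterlim_Suc] by (simp add: a_def p_def \<Delta>z)
  qed
  then have dir: "(\<lambda>k. norm (d (Suc k) - ?S ((z k - z_star) - L_star (z k - z_star))))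
    \<in> o(\<lambda>k. norm (z k - z_star))"
    by (simp add: L_eq d_def a_def p_def)
  \<comment> \<open>With this map, \<open>V\<close> is the image of \<open>U\<close> and
    \<open>dir\<close> says d_{k+1} = M e_k + o(e_k).\<close>
  define M where "M h = ?S (h - L_star h)" for h
  have linM: "bounded_linear M"
    unfolding M_def[abs_def] L_eq
    by (intro bounded_linear_compose[OF linS] bounded_linear_sub bounded_linear_add
        bounded_linear_ident bounded_linear_const_scaleR bounded_linear_compose[OF linQ] linS)
  have V: "V = M ` U" by (simp add: V_def M_def[abs_def])
  have subV: "subspace V"
    unfolding V using linM U by (intro linear_subspace_image bounded_linear.linear)
  \<comment> \<open>Boundedness of \<open>G_star\<close> bounds its inverse from below, which
    carries the constant \<open>c\<^sub>z\<close> over to \<open>M\<close>; the \<open>+ 1\<close>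
    makes the divisor positive.\<close>
  have low: "norm v \<le> (norm G_star + 1) * norm (?S v)" for v
  proof -
    have "norm v = norm (blinfun_apply G_star (?S v))"
      using bij by (simp add: bij_is_surj surj_f_inv_f)
    also have "\<dots> \<le> norm G_star * norm (?S v)" by (rule norm_blinfun)
    finally show ?thesis by (simp add: distrib_right) (smt (verit) norm_ge_zero)
  qed
  have "\<forall>\<^sub>F k in sequentially. c\<^sub>z / (norm G_star + 1) * norm (z k - z_star) \<le> norm (M (z k - z_star))"
    using cz(2)
  proof eventually_elim
    case (elim k)
    with low[of "(z k - z_star) - L_star (z k - z_star)"]
    have "c\<^sub>z * norm (z k - z_star) \<le> (norm G_star + 1) * norm (M (z k - z_star))"
      unfolding M_def by linarith
    moreover have "norm G_star + 1 > 0" using norm_ge_zero[of G_star] by linarith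
    ultimately show ?case by (simp add: divide_le_eq mult.commute)
  qed
  then have "(\<lambda>k. infdist (d (Suc k)) V / norm (d (Suc k))) \<longlonglongrightarrow> 0"
    unfolding V using U linM U_lim dir cz(1) z_ne
    by (intro infdist_ratio_linear_image[where c = "c\<^sub>z / (norm G_star + 1)"])
      (auto simp: M_def add_nonneg_pos)
  then have dV: "(\<lambda>k. infdist (d k) V / norm (d k)) \<longlonglongrightarrow> 0" by (rule LIMSEQ_imp_Suc)
  have "continuous_on UNIV (hess f)"
    using c2 by (simp add: twice_continuously_differentiable_def)
  then have "continuous_on UNIV (\<lambda>y. id_blinfun + \<gamma> *\<^sub>R hess f y)"
    by (intro continuous_intros)
  from integral_segment_tendsto[OF this p_lim d_lim]
  have Gbar_lim: "(\<lambda>k. Gbar k) \<longlonglongrightarrow> G_star"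
    unfolding Gbar \<phi> hess_prox_objective[OF c2] G_star .
  show ?thesis
    by (intro conjI impI dV dennis_more_of_subspace[OF subV dV Gbar_lim])
qed

end
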